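(* Let $H$ be a crown-free linear $3$-graph with $n$ vertices such that $H$ has no edge $e$ with $D(e) \geq (4,4,3)$ and no edge $e$ with $D(e) \geq (5,4,2)$. Then $|E(H)| \leq \frac{3n}{2}$.
   Context: A (linear) $3$-graph $H=(V,E)$ consists of a finite vertex set $V$ and a set $E$ of $3$-element subsets of $V$ (edges) such that any two distinct edges intersect in at most one vertex; $d(v)$ denotes the number of edges containing $v$. A crown is the $3$-graph consisting of three pairwise disjoint edges together with a fourth edge intersecting each of them; $H$ is crown-free if no four edges of $H$ form a crown. For an edge $e=\{a,b,c\}$, $D(e)$ is the vector $(d(a),d(b),d(c))$ with coordinates arranged in non-increasing order. For two such vectors, $D(e) \geq (x,y,z)$ means coordinatewise: the first coordinate of $D(e)$ is at least $x$, the second at least $y$, and the third at least $z$. *)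

theory Defs
  imports Complex_Main "HOL-Library.Multiset"
begin

definition linear_3_graph :: "'a set \<Rightarrow> 'a set set \<Rightarrow> bool" where
  "linear_3_graph V E \<longleftrightarrow>
     finite V \<and>
     (\<forall>e\<in>E. e \<subseteq> V \<and> card e = 3) \<and>
     (\<forall>e\<in>E. \<forall>f\<in>E. e \<noteq> f \<longrightarrow> card (e \<inter> f) \<le> 1)"

definition degree :: "'a set set \<Rightarrow> 'a \<Rightarrow> nat" where
  "degree E v = card {e \<in> E. v \<in> e}"

definition is_crown :: "'a set set \<Rightarrow> bool" where
  "is_crown F \<longleftrightarrow>
     (\<exists>e1 e2 e3 f. F = {e1, e2, e3, f} \<and> distinct [e1, e2, e3, f] \<and> (\<forall>e\<in>F. card e = 3) \<and>
        e1 \<inter> e2 = {} \<and> e1 \<inter> e3 = {} \<and> e2 \<inter> e3 = {} \<and>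
        f \<inter> e1 \<noteq> {} \<and> f \<inter> e2 \<noteq> {} \<and> f \<inter> e3 \<noteq> {})"

definition crown_free :: "'a set set \<Rightarrow> bool" where
  "crown_free E \<longleftrightarrow> (\<forall>F\<subseteq>E. \<not> is_crown F)"

text \<open>A multiset image, since vertices of equal degree must each contribute a coordinate.\<close>

definition degree_vector :: "'a set set \<Rightarrow> 'a set \<Rightarrow> nat list" where
  "degree_vector E e = rev (sorted_list_of_multiset (image_mset (degree E) (mset_set e)))"

definition vector_ge :: "nat list \<Rightarrow> nat list \<Rightarrow> bool" where
  "vector_ge xs ys \<longleftrightarrow> list_all2 (\<ge>) xs ys"

end

theory Submission
  imports Defs
begin

text \<open>Each edge receives the weight \<open>1 / d(v)\<close> from each of its vertices \<open>v\<close>, so the total weight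
  is the number of non-isolated vertices, hence at most \<open>n\<close>. The two forbidden degree vectors leave
  only edges of weight at least \<open>2/3\<close>: if the smallest degree is at least 3 then \<open>(4,4,3)\<close> forces
  the two smallest degrees to equal 3; if it is 2 then \<open>(5,4,2)\<close> forces the second degree to be at
  most 3 or all degrees to be at most 4; if it is 1 there is nothing to do.\<close>

text \<open>Distinctness keeps three entries in \<open>mset_set\<close>, so equal degrees survive as
  repeated coordinates; the assumed order decides every comparison of the sort.\<close>

lemma degree_vector_sorted:
  assumes "degree E x \<ge> degree E y" "degree E y \<ge> degree E z" "x \<noteq> y" "x \<noteq> z" "y \<noteq> z"
  shows "degree_vector E {x, y, z} = [degree E x, degree E y, degree E z]"
  using assms by (auto simp: degree_vector_def)

text \<open>With \<open>degree E\<close> for \<open>f\<close>, this names the vertices of an edge in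
  the order in which its degree vector lists them.\<close>

lemma card_3_sorted_by:
  fixes f :: "'a \<Rightarrow> 'b::linorder"
  assumes "card e = 3"
  obtains x y z where "e = {x, y, z}" "x \<noteq> y" "x \<noteq> z" "y \<noteq> z" "f x \<ge> f y" "f y \<ge> f z"
proof -
  obtain a b c where abc: "e = {a, b, c}" "a \<noteq> b" "a \<noteq> c" "b \<noteq> c"
    using assms by (auto simp: card_3_iff)
  consider "f a \<ge> f b" "f b \<ge> f c" | "f a \<ge> f c" "f c \<ge> f b" | "f b \<ge> f a" "f a \<ge> f c"
    | "f b \<ge> f c" "f c \<ge> f a" | "f c \<ge> f a" "f a \<ge> f b" | "f c \<ge> f b" "f b \<ge> f a"
    by (meson linear)
  then show thesis
  proof cases
    case 1 then show ?thesis using abc by (intro that[of a b c]) auto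
  next
    case 2 then show ?thesis using abc by (intro that[of a c b]) auto
  next
    case 3 then show ?thesis using abc by (intro that[of b a c]) auto
  next
    case 4 then show ?thesis using abc by (intro that[of b c a]) auto
  next
    case 5 then show ?thesis using abc by (intro that[of c a b]) auto
  next
    case 6 then show ?thesis using abc by (intro that[of c b a]) auto
  qed
qed

lemma sum_inverse_degrees_ge:
  fixes a b c :: nat
  assumes "a \<ge> b" "b \<ge> c" "c > 0"
    and no443: "\<not> (a \<ge> 4 \<and> b \<ge> 4 \<and> c \<ge> 3)"
    and no542: "\<not> (a \<ge> 5 \<and> b \<ge> 4 \<and> c \<ge> 2)"
  shows "1 / real a + 1 / real b + 1 / real c \<ge> 2 / 3"
proof -
  have inv: "1 / real k \<ge> 1 / real m" if "k \<le> m" "k > 0" for k m :: nat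
    using that by (simp add: frac_le)
  consider "c = 1" | "c = 2" "b \<le> 3" | "c = 2" "b \<le> 4" "a \<le> 4" | "b \<le> 3" "c \<le> 3"
    using assms by linarith
  then show ?thesis
  proof cases
    case 1
    then show ?thesis by (simp add: add_increasing)
  next
    case 2
    have "0 \<le> 1 / real a" "1 / real b \<ge> 1 / 3" "1 / real c = 1 / 2"
      using inv[of b 3] 2 assms by auto
    then show ?thesis by linarith
  next
    case 3
    have "1 / real a \<ge> 1 / 4" "1 / real b \<ge> 1 / 4" "1 / real c = 1 / 2"
      using inv[of a 4] inv[of b 4] 3 assms by auto
    then show ?thesis by linarith
  next
    case 4
    \<comment> \<open>\<open>a\<close> is unbounded here, so its term is only known to be
      nonnegative; the other two give exactly the threshold \<open>2 / 3\<close>.\<close>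
    have "0 \<le> 1 / real a" "1 / real b \<ge> 1 / 3" "1 / real c \<ge> 1 / 3"
      using inv[of b 3] inv[of c 3] 4 assms by auto
    then show ?thesis by linarith
  qed
qed

text \<open>Double counting: after exchanging the sums, a vertex \<open>v\<close> collects
  \<open>degree E v\<close> copies of \<open>1 / degree E v\<close>.\<close>

lemma sum_inverse_degree_le_card:
  assumes "finite V" "finite E" "\<And>e. e \<in> E \<Longrightarrow> e \<subseteq> V"
  shows "(\<Sum>e\<in>E. \<Sum>v\<in>e. 1 / real (degree E v)) \<le> real (card V)"
proof -
  have "(\<Sum>e\<in>E. \<Sum>v\<in>e. 1 / real (degree E v)) = (\<Sum>e\<in>E. \<Sum>v | v \<in> V \<and> v \<in> e. 1 / real (degree E v))"
    using assms(3) by (intro sum.cong) auto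
  also have "\<dots> = (\<Sum>v\<in>V. \<Sum>e | e \<in> E \<and> v \<in> e. 1 / real (degree E v))"
    using assms by (intro sum.swap_restrict)
  \<comment> \<open>The inner sum is 1, except at isolated vertices, where it is empty and equals
    0.\<close>
  also have "\<dots> \<le> (\<Sum>v\<in>V. 1)"
    by (intro sum_mono) (simp add: degree_def)
  finally show ?thesis by simp
qed

theorem theorem2:
  fixes V :: "'a set" and E :: "'a set set" and n :: nat
  assumes "linear_3_graph V E"
    and "card V = n"
    and "crown_free E"
    and "\<not> (\<exists>e\<in>E. vector_ge (degree_vector E e) [4, 4, 3])"
    and "\<not> (\<exists>e\<in>E. vector_ge (degree_vector E e) [5, 4, 2])"
  shows "real (card E) \<le> 3 * real n / 2"
proof -
  have finV: "finite V" and sub: "\<And>e. e \<in> E \<Longrightarrow> e \<subseteq> V" and card3: "\<And>e. e \<in> E \<Longrightarrow> card e = 3"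
    using assms(1) by (auto simp: linear_3_graph_def)
  have finE: "finite E"
    using finV sub by (meson PowI finite_Pow_iff finite_subset subsetI)
  have weight: "2 / 3 \<le> (\<Sum>v\<in>e. 1 / real (degree E v))" if e: "e \<in> E" for e
  proof -
    obtain x y z where xyz: "e = {x, y, z}" "x \<noteq> y" "x \<noteq> z" "y \<noteq> z"
      and ord: "degree E x \<ge> degree E y" "degree E y \<ge> degree E z"
      using card_3_sorted_by[OF card3[OF e]] by metis
    \<comment> \<open>\<open>e\<close> itself is counted at \<open>z\<close>. Positivity excludes
      the default value \<open>1 / 0 = 0\<close>, which would spoil the lower bound.\<close>
    have "degree E z > 0"
      using e xyz finE by (auto simp: degree_def card_gt_0_iff)
    moreover have "degree_vector E e = [degree E x, degree E y, degree E z]"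
      using degree_vector_sorted ord xyz by metis
    ultimately have "2 / 3 \<le> 1 / real (degree E x) + 1 / real (degree E y) + 1 / real (degree E z)"
      using assms(4,5) e ord by (intro sum_inverse_degrees_ge) (auto simp: vector_ge_def)
    then show ?thesis using xyz by (simp add: add.assoc)
  qed
  have "real (card E) * (2 / 3) \<le> (\<Sum>e\<in>E. \<Sum>v\<in>e. 1 / real (degree E v))"
    using weight by (intro sum_bounded_below)
  also have "\<dots> \<le> real n"
    using sum_inverse_degree_le_card[OF finV finE sub] assms(2) by simp
  finally show ?thesis by simp
qed

end
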